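(* Let $0<\alpha<1$ and $T>0$. For every $A,B\in\mathbb{R}$, the function $u:\mathbb{R}_0^+\times(0,T)\to\mathbb{R}$ given by $$u(x,t)=A+B\int_0^{x/t^{\frac{1}{1+\alpha}}}\sigma_\alpha(w)\,dw$$ is a solution to the space-fractional diffusion equation $$u_t(x,t)=\frac{\partial}{\partial x}\,{}^C_0D_x^\alpha u(x,t),\qquad x>0,\ 0<t<T.$$
   Context: For $0<\alpha<1$ the Caputo derivative in the space variable is ${}^C_0D_x^{\alpha}u(x,t)=\frac{1}{\Gamma(1-\alpha)}\int_0^x\frac{u_x(p,t)}{(x-p)^\alpha}\,dp$. The equation is understood pointwise: all derivatives and integrals involved exist (the integral defining the Caputo derivative converging absolutely) and the identity holds. Here $\mathbb{R}_0^+=[0,\infty)$. The three-parametric Mittag-Leffler function is, for $\alpha>0$, $m>0$ and $l$ with $\alpha(jm+l)\neq-1,-2,-3,\dots$ for $j=0,1,2,\dots$, $$E_{\alpha,m,l}(z)=\sum_{n=0}^\infty c_nz^n,\qquad c_0=1,\quad c_n=\prod_{j=0}^{n-1}\frac{\Gamma(\alpha(jm+l)+1)}{\Gamma(\alpha(jm+l+1)+1)}\ (n\ge1).$$ The function $\sigma_\alpha:\mathbb{R}^+\to\mathbb{R}$ is $\sigma_\alpha(w)=w^{\alpha-1}E_{\alpha,1+\frac1\alpha,1}\left(-\frac{w^{1+\alpha}}{1+\alpha}\right)$. *)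

theory Defs
  imports "HOL-Analysis.Analysis"
begin

text \<open>
  The three-parametric Mittag-Leffler function (real argument). The intended parameters are
  \<open>\<alpha> > 0\<close>, \<open>m > 0\<close> and \<open>l\<close> with \<open>\<alpha> * (j * m + l)\<close> different from \<open>-1, -2, -3, \<dots>\<close> for all naturals
  \<open>j\<close>, so that no numerator meets a pole of the Gamma function.
\<close>

definition mittag_leffler3_coeff :: "real \<Rightarrow> real \<Rightarrow> real \<Rightarrow> nat \<Rightarrow> real" where
  "mittag_leffler3_coeff \<alpha> m l n =
     (\<Prod>j<n. Gamma (\<alpha> * (real j * m + l) + 1) / Gamma (\<alpha> * (real j * m + l + 1) + 1))"

definition mittag_leffler3 :: "real \<Rightarrow> real \<Rightarrow> real \<Rightarrow> real \<Rightarrow> real" where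
  "mittag_leffler3 \<alpha> m l z = (\<Sum>n. mittag_leffler3_coeff \<alpha> m l n * z ^ n)"

definition sigma_fun :: "real \<Rightarrow> real \<Rightarrow> real" where
  "sigma_fun \<alpha> w =
     w powr (\<alpha> - 1) * mittag_leffler3 \<alpha> (1 + 1 / \<alpha>) 1 (- (w powr (1 + \<alpha>)) / (1 + \<alpha>))"

text \<open>
  Integrals from \<open>0\<close> to \<open>x > 0\<close> are Lebesgue integrals over the open interval, so neither the
  derivative of \<open>f\<close> at \<open>0\<close> nor the kernel at \<open>p = x\<close> plays a role. Only the values of \<open>f\<close> on
  the open interval \<open>(0, x)\<close> matter.
\<close>

definition caputo_deriv :: "real \<Rightarrow> (real \<Rightarrow> real) \<Rightarrow> real \<Rightarrow> real" where
  "caputo_deriv \<alpha> f x =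
     1 / Gamma (1 - \<alpha>) * (LBINT p=0..x. deriv f p / (x - p) powr \<alpha>)"

definition caputo_differentiable :: "real \<Rightarrow> (real \<Rightarrow> real) \<Rightarrow> real \<Rightarrow> bool" where
  "caputo_differentiable \<alpha> f x \<longleftrightarrow>
     (\<forall>p\<in>{0<..<x}. f differentiable (at p)) \<and>
     interval_lebesgue_integrable lborel 0 x (\<lambda>p. deriv f p / (x - p) powr \<alpha>)"

text \<open>
  Pointwise solutions: the common value \<open>D\<close> is both the time derivative of \<open>u\<close> and the space
  derivative of its Caputo derivative. All derivatives are taken at interior points of the domain
  \<open>[0, \<infinity>) \<times> (0, T)\<close>, so the values of \<open>u\<close> outside it are irrelevant.
\<close>

definition space_fractional_diffusion_solution ::
    "real \<Rightarrow> real \<Rightarrow> (real \<Rightarrow> real \<Rightarrow> real) \<Rightarrow> bool" where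
  "space_fractional_diffusion_solution \<alpha> T u \<longleftrightarrow>
     (\<forall>x>0. \<forall>t\<in>{0<..<T}.
        caputo_differentiable \<alpha> (\<lambda>p. u p t) x \<and>
        (\<exists>D. ((\<lambda>s. u x s) has_real_derivative D) (at t) \<and>
             ((\<lambda>y. caputo_deriv \<alpha> (\<lambda>p. u p t) y) has_real_derivative D) (at x)))"

end

theory Submission imports Defs begin

text \<open>
  Put \<open>\<beta> = 1 + \<alpha>\<close>, so that \<open>\<sigma>(w) = (\<Sum>n. s\<^sub>n w\<^bsup>\<beta>n + \<alpha> - 1\<^esup>)\<close> with
  \<open>s\<^sub>n\<^sub>+\<^sub>1 = - s\<^sub>n \<Gamma>(\<beta>(n + 1)) / (\<beta> \<Gamma>(\<beta>(n + 1) + \<alpha>))\<close>. Integrating termwise by means of the Beta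
  integral, the Caputo derivative of \<open>\<integral>\<sigma>\<close> is
  \<open>G(w) = (\<Sum>n. s\<^sub>n \<Gamma>(\<beta>n + \<alpha>) / \<Gamma>(\<beta>n + 1) w\<^bsup>\<beta>n\<^esup>)\<close>, and the recursion for \<open>s\<^sub>n\<close> collapses
  its derivative to \<open>G'(w) = - w \<sigma>(w) / \<beta>\<close>. With \<open>c = t\<^bsup>-1/\<beta>\<^esup>\<close>, the Caputo derivative of \<open>u\<close> is
  \<open>B c\<^bsup>\<alpha>\<^esup> G(c x)\<close>; since \<open>c\<^bsup>\<beta>\<^esup> = 1 / t\<close>, both sides of the equation equal
  \<open>- B c x \<sigma>(c x) / (\<beta> t)\<close>.
\<close>

section \<open>Decay of quotients of Gamma values\<close>

text \<open>Log-convexity of \<open>Gamma\<close>, applied to x + 1 = a (x + a) + (1 - a) (x + a +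
  1), combined with the functional equation at x + a and at x.\<close>

lemma Gamma_div_Gamma_add_le:
  fixes x a :: real
  assumes "0 < x" "0 < a" "a < 1"
  shows "Gamma x / Gamma (x + a) \<le> (x + a) powr (1 - a) / x"
proof -
  have pos: "Gamma x > 0" "Gamma (x + a) > 0"
    using assms by (auto intro!: Gamma_real_pos)
  then have nz: "Gamma x \<noteq> 0" "Gamma (x + a) \<noteq> 0"
    by linarith+
  have "ln (Gamma (x + 1)) \<le> a * ln (Gamma (x + a)) + (1 - a) * ln (Gamma (x + a + 1))"
    using convex_onD[OF log_convex_Gamma_real, of "1 - a" "x + a" "x + a + 1"] assms
    by (simp add: o_def algebra_simps)
  also have "Gamma (x + a + 1) = (x + a) * Gamma (x + a)"
    using assms by (intro Gamma_plus1) (auto elim!: nonpos_Ints_cases)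
  also have "ln \<dots> = ln (x + a) + ln (Gamma (x + a))"
    using assms pos nz by (simp add: ln_mult)
  also have "a * ln (Gamma (x + a)) + (1 - a) * (ln (x + a) + ln (Gamma (x + a)))
      = ln ((x + a) powr (1 - a) * Gamma (x + a))"
    using assms pos nz by (simp add: ln_mult ln_powr algebra_simps)
  finally have "Gamma (x + 1) \<le> (x + a) powr (1 - a) * Gamma (x + a)"
    using assms pos nz by (subst (asm) ln_le_cancel_iff) (auto intro!: Gamma_real_pos)
  moreover have "Gamma (x + 1) = x * Gamma x"
    using assms by (intro Gamma_plus1) (auto elim!: nonpos_Ints_cases)
  ultimately show ?thesis
    using assms pos nz by (simp add: field_simps)
qed

text \<open>The preceding bound is of order \<open>x powr (- a)\<close>. Such quotients are, up to a
  constant, the ratios of successive coefficients of \<sigma>, so this limit makes its series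
  converge everywhere.\<close>

lemma Gamma_div_Gamma_add_tendsto_0:
  fixes a :: real
  assumes "0 < a" "a < 1"
  shows "((\<lambda>x. Gamma x / Gamma (x + a)) \<longlongrightarrow> 0) at_top"
proof (rule tendsto_sandwich)
  show "\<forall>\<^sub>F x in at_top. 0 \<le> Gamma x / Gamma (x + a)"
    using eventually_gt_at_top[of 0]
    by eventually_elim (use assms in \<open>auto intro!: divide_nonneg_nonneg less_imp_le[OF Gamma_real_pos]\<close>)
  show "\<forall>\<^sub>F x in at_top. Gamma x / Gamma (x + a) \<le> (x + a) powr (1 - a) / x"
    using eventually_gt_at_top[of 0]
    by eventually_elim (use assms in \<open>auto intro!: Gamma_div_Gamma_add_le\<close>)
  show "((\<lambda>x. (x + a) powr (1 - a) / x) \<longlongrightarrow> 0) at_top"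
    using assms by real_asymp
qed simp

section \<open>The Beta integral and termwise fractional integration\<close>

text \<open>The substitution t = p / x in the Beta integral; the two powers of the integrand give
  the exponent a + b - 2 and the Jacobian one more.\<close>

lemma has_bochner_integral_Beta_scaled:
  fixes a b x :: real
  assumes "0 < a" "0 < b" "0 < x"
  shows "has_bochner_integral lborel
    (\<lambda>p. indicator {0<..<x} p * (p powr (a - 1) * (x - p) powr (b - 1)))
    (x powr (a + b - 1) * Beta a b)"
proof -
  let ?f = "\<lambda>t. indicator {0..1} t * (t powr (a - 1) * (1 - t) powr (b - 1))"
  have int: "integrable lborel ?f"
    using integrable_Beta[of a b] assms by (simp add: set_integrable_def)
  have "(LINT t:{0..1}|lborel. t powr (a - 1) * (1 - t) powr (b - 1)) = Beta a b"
    using set_borel_integral_eq_integral(2)[OF integrable_Beta[of a b]]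
      has_integral_Beta_real[of a b] assms by (simp add: integral_unique)
  with int have "has_bochner_integral lborel ?f (Beta a b)"
    by (simp add: has_bochner_integral_iff set_lebesgue_integral_def)
  then have "has_bochner_integral lborel (\<lambda>p. ?f (0 + inverse x * p)) (Beta a b /\<^sub>R \<bar>inverse x\<bar>)"
    using assms by (subst (asm) lborel_has_bochner_integral_real_affine_iff[of "inverse x" _ _ 0]) auto
  then have "has_bochner_integral lborel (\<lambda>p. x powr (a + b - 2) * ?f (inverse x * p))
      (x powr (a + b - 2) * (x * Beta a b))"
    using assms by (intro has_bochner_integral_mult_right) (simp_all add: mult_ac)
  moreover have "x powr (a + b - 2) * (x * Beta a b) = x powr (a + b - 1) * Beta a b"
    using powr_add[of x "a + b - 2" 1] assms by simp
  moreover have "x powr (a + b - 2) * ?f (inverse x * p)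
      = indicator {0<..<x} p * (p powr (a - 1) * (x - p) powr (b - 1))" for p
  proof (cases "0 < p \<and> p < x")
    case True
    then have "1 - inverse x * p = (x - p) / x"
      using assms by (simp add: field_simps)
    moreover have "x powr (a + b - 2) = x powr (a - 1) * x powr (b - 1)"
      by (simp flip: powr_add)
    ultimately show ?thesis
      using True assms by (simp add: powr_divide powr_mult field_simps indicator_def)
  next
    case False
    then show ?thesis
      \<comment> \<open>At the endpoints both sides vanish because \<open>0 powr y = 0\<close> for
        every y, so the closed and the open indicator agree here.\<close>
      using assms by (cases "p = 0 \<or> p = x") (auto simp: indicator_def field_simps zero_less_mult_iff)
  qed
  ultimately show ?thesis by simp
qed

text \<open>For \<open>b = 1\<close> this is the ordinary integral, for \<open>b = 1 - \<alpha>\<close> it is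
  \<open>\<Gamma>(1 - \<alpha>)\<close> times the Riemann--Liouville integral of order \<open>1 - \<alpha>\<close>.\<close>

lemma powr_series_fractional_integral:
  fixes a :: "nat \<Rightarrow> real" and b c d x :: real
  assumes summ: "\<And>z. summable (\<lambda>n. a n * z ^ n)"
    and "0 < b" "0 < c" "0 < d" "0 < x"
  shows "has_bochner_integral lborel
    (\<lambda>p. indicator {0<..<x} p * (p powr (c - 1) * (\<Sum>n. a n * (p powr d) ^ n) * (x - p) powr (b - 1)))
    (x powr (c + b - 1) * (\<Sum>n. a n * Beta (d * real n + c) b * (x powr d) ^ n))"
proof -
  let ?k = "\<lambda>n p. indicator {0<..<x} p * (p powr (d * real n + c - 1) * (x - p) powr (b - 1))"
  let ?v = "\<lambda>n. x powr (c + b - 1) * ((x powr d) ^ n * Beta (d * real n + c) b)"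
  \<comment> \<open>Convergence at z + 1 gives absolute convergence at the smaller point z.\<close>
  have summ_abs: "summable (\<lambda>n. \<bar>a n\<bar> * z ^ n)" if "0 \<le> z" for z
    using powser_insidea[OF summ[of "z + 1"], of z] that by (simp add: abs_mult power_abs)
  have powr_power_eq: "(p powr d) ^ n = p powr (d * real n)" if "0 < p" for p n
    using that by (simp add: powr_powr flip: powr_realpow)
  have k: "has_bochner_integral lborel (?k n) (?v n)" for n
  proof -
    have "x powr (d * real n + c + b - 1) = x powr (c + b - 1) * (x powr d) ^ n"
      using assms by (simp add: powr_power_eq algebra_simps flip: powr_add)
    then show ?thesis
      using has_bochner_integral_Beta_scaled[of "d * real n + c" b x] assms
      by (simp add: add_nonneg_pos mult_ac)
  qed
  have k_nonneg: "0 \<le> ?k n p" for n p by simp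
  have ak: "has_bochner_integral lborel (\<lambda>p. a n * ?k n p) (a n * ?v n)" for n
    by (rule has_bochner_integral_mult_right) (rule k)
  have term_eq: "a n * ?k n p
      = indicator {0<..<x} p * p powr (c - 1) * (x - p) powr (b - 1) * (a n * (p powr d) ^ n)" for n p
    by (cases "0 < p \<and> p < x") (auto simp: powr_power_eq powr_add[symmetric] algebra_simps)
  have norm_int: "(\<integral>p. norm (a n * ?k n p) \<partial>lborel) = \<bar>a n\<bar> * ?v n" for n
    using k[of n] k_nonneg[of n]
    by (simp add: has_bochner_integral_iff abs_mult)
  \<comment> \<open>This is the hypothesis that justifies exchanging sum and integral.
    \<open>Beta\<close> decreases in its first argument, so each Beta factor is at most the one for
    n = 0 and the power series itself dominates.\<close>
  have "summable (\<lambda>n. \<bar>a n\<bar> * ?v n)"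
  proof (rule summable_comparison_test)
    have "\<bar>a n\<bar> * ?v n \<le> x powr (c + b - 1) * Beta c b * (\<bar>a n\<bar> * (x powr d) ^ n)" for n
    proof -
      have "Beta (d * real n + c) b \<le> Beta c b"
        using assms by (intro Beta_real_mono) auto
      then have "(\<bar>a n\<bar> * x powr (c + b - 1) * (x powr d) ^ n) * Beta (d * real n + c) b
          \<le> (\<bar>a n\<bar> * x powr (c + b - 1) * (x powr d) ^ n) * Beta c b"
        by (intro mult_left_mono) auto
      then show ?thesis by (simp add: mult_ac)
    qed
    moreover have "0 \<le> \<bar>a n\<bar> * ?v n" for n
      using assms by (auto simp: Beta_def add_nonneg_pos
          intro!: mult_nonneg_nonneg divide_nonneg_nonneg less_imp_le[OF Gamma_real_pos])
    ultimately show "\<exists>N. \<forall>n\<ge>N. norm (\<bar>a n\<bar> * ?v n)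
        \<le> x powr (c + b - 1) * Beta c b * (\<bar>a n\<bar> * (x powr d) ^ n)"
      by (metis abs_of_nonneg real_norm_def)
    show "summable (\<lambda>n. x powr (c + b - 1) * Beta c b * (\<bar>a n\<bar> * (x powr d) ^ n))"
      by (intro summable_mult summ_abs) auto
  qed
  then have sums: "summable (\<lambda>n. \<integral>p. norm (a n * ?k n p) \<partial>lborel)"
    by (simp only: norm_int)
  have "summable (\<lambda>n. norm (a n * ?k n p))" for p
    unfolding term_eq using summ_abs[of "p powr d"]
    by (simp add: abs_mult power_abs summable_mult)
  then have AE: "AE p in lborel. summable (\<lambda>n. norm (a n * ?k n p))"
    by simp
  have int: "integrable lborel (\<lambda>p. a n * ?k n p)" for n
    using ak[of n] by (simp add: has_bochner_integral_iff)
  have "has_bochner_integral lborel (\<lambda>p. \<Sum>n. a n * ?k n p) (\<Sum>n. \<integral>p. a n * ?k n p \<partial>lborel)"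
    unfolding has_bochner_integral_iff
    using integrable_suminf[OF int AE sums] integral_suminf[OF int AE sums] by blast
  also have "(\<lambda>p. \<Sum>n. a n * ?k n p) = (\<lambda>p. indicator {0<..<x} p *
      (p powr (c - 1) * (\<Sum>n. a n * (p powr d) ^ n) * (x - p) powr (b - 1)))"
    unfolding term_eq by (subst suminf_mult[OF summ]) (simp add: mult_ac)
  also have "(\<lambda>n. \<integral>p. a n * ?k n p \<partial>lborel) = (\<lambda>n. a n * ?v n)"
    by (intro ext has_bochner_integral_integral_eq ak)
  also have "(\<lambda>n. a n * ?v n) = (\<lambda>n. x powr (c + b - 1) * (a n * Beta (d * real n + c) b * (x powr d) ^ n))"
    by (simp add: mult_ac)
  also have "(\<Sum>n. x powr (c + b - 1) * (a n * Beta (d * real n + c) b * (x powr d) ^ n))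
      = x powr (c + b - 1) * (\<Sum>n. a n * Beta (d * real n + c) b * (x powr d) ^ n)"
  proof (rule suminf_mult)
    \<comment> \<open>The integrals of the terms are already summable; dividing by the nonzero power
      of x leaves the required series.\<close>
    have "summable (\<lambda>n. inverse (x powr (c + b - 1)) * (a n * ?v n))"
      using summable_integral[OF int AE sums]
      unfolding has_bochner_integral_integral_eq[OF ak] by (rule summable_mult)
    then show "summable (\<lambda>n. a n * Beta (d * real n + c) b * (x powr d) ^ n)"
      using assms by (simp add: field_simps)
  qed
  finally show ?thesis .
qed

lemma powr_series_integrable:
  fixes a :: "nat \<Rightarrow> real" and c d x :: real
  assumes "\<And>z. summable (\<lambda>n. a n * z ^ n)" "0 < c" "0 < d" "0 \<le> x"
  shows "interval_lebesgue_integrable lborel 0 (ereal x) (\<lambda>p. p powr (c - 1) * (\<Sum>n. a n * (p powr d) ^ n))"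
proof (cases "x = 0")
  case True
  then show ?thesis
    by (simp add: interval_lebesgue_integrable_def einterval_def set_integrable_def flip: zero_ereal_def)
next
  case False
  then have "integrable lborel
      (\<lambda>p. indicator {0<..<x} p * (p powr (c - 1) * (\<Sum>n. a n * (p powr d) ^ n) * (x - p) powr (1 - 1)))"
    using powr_series_fractional_integral[of a 1 c d x] assms
    by (simp add: has_bochner_integral_iff)
  \<comment> \<open>With b = 1 the kernel is a zeroth power: it is 1 except at p = x, where
    \<open>0 powr 0 = 0\<close>, and that point lies outside the open interval.\<close>
  also have "(\<lambda>p. indicator {0<..<x} p * (p powr (c - 1) * (\<Sum>n. a n * (p powr d) ^ n) * (x - p) powr (1 - 1)))
      = (\<lambda>p. indicator {0<..<x} p * (p powr (c - 1) * (\<Sum>n. a n * (p powr d) ^ n)))"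
    by (auto simp: indicator_def)
  finally show ?thesis
    using assms by (simp add: interval_lebesgue_integrable_def set_integrable_def zero_ereal_def)
qed

section \<open>Power series, integrability and primitive of \<sigma>\<close>

definition sigma_coeff :: "real \<Rightarrow> nat \<Rightarrow> real" where
  "sigma_coeff \<alpha> n = mittag_leffler3_coeff \<alpha> (1 + 1 / \<alpha>) 1 n * (- 1 / (1 + \<alpha>)) ^ n"

lemma sigma_fun_eq_series:
  "sigma_fun \<alpha> w = w powr (\<alpha> - 1) * (\<Sum>n. sigma_coeff \<alpha> n * (w powr (1 + \<alpha>)) ^ n)"
proof -
  have "(- (w powr (1 + \<alpha>)) / (1 + \<alpha>)) ^ n = (- 1 / (1 + \<alpha>)) ^ n * (w powr (1 + \<alpha>)) ^ n" for n
    by (simp flip: power_mult_distrib)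
  then show ?thesis
    by (simp add: sigma_fun_def mittag_leffler3_def sigma_coeff_def mult.assoc)
qed

text \<open>For m = 1 + 1 / \<alpha> and l = 1 the Gamma arguments of the Mittag-Leffler product
  simplify to multiples of 1 + \<alpha>, shifted by \<alpha> in the denominator.\<close>

lemma sigma_coeff_Suc:
  assumes "0 < \<alpha>"
  shows "sigma_coeff \<alpha> (Suc n) = - 1 / (1 + \<alpha>) * sigma_coeff \<alpha> n
    * (Gamma ((1 + \<alpha>) * real (Suc n)) / Gamma ((1 + \<alpha>) * real (Suc n) + \<alpha>))"
proof -
  have "\<alpha> * (real n * (1 + 1 / \<alpha>) + 1) + 1 = (1 + \<alpha>) * real (Suc n)"
    using assms by (simp add: field_simps)
  moreover have "\<alpha> * (real n * (1 + 1 / \<alpha>) + 1 + 1) + 1 = (1 + \<alpha>) * real (Suc n) + \<alpha>"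
    using assms by (simp add: field_simps)
  ultimately show ?thesis
    by (simp add: sigma_coeff_def mittag_leffler3_coeff_def mult_ac del: of_nat_Suc)
qed

text \<open>The ratio test applies for every z, since the Gamma quotient in the recursion tends to 0
  and outweighs the fixed factor z.\<close>

lemma summable_sigma_coeff:
  assumes "0 < \<alpha>" "\<alpha> < 1"
  shows "summable (\<lambda>n. sigma_coeff \<alpha> n * z ^ n)"
proof -
  let ?r = "\<lambda>n. Gamma ((1 + \<alpha>) * real (Suc n)) / Gamma ((1 + \<alpha>) * real (Suc n) + \<alpha>)"
  have "filterlim (\<lambda>n. (1 + \<alpha>) * real (Suc n)) at_top sequentially"
    using assms by real_asymp
  with Gamma_div_Gamma_add_tendsto_0[OF assms] have "?r \<longlonglongrightarrow> 0"
    by (rule filterlim_compose)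
  then have "(\<lambda>n. norm (- 1 / (1 + \<alpha>) * z * ?r n)) \<longlonglongrightarrow> 0"
    by (intro tendsto_norm_zero tendsto_mult_right_zero)
  then have "\<forall>\<^sub>F n in sequentially. norm (- 1 / (1 + \<alpha>) * z * ?r n) < 1 / 2"
    by (rule order_tendstoD) simp
  then obtain N where N: "norm (- 1 / (1 + \<alpha>) * z * ?r n) < 1 / 2" if "N \<le> n" for n
    by (auto simp: eventually_sequentially)
  show ?thesis
  proof (rule summable_ratio_test[of "1 / 2" N])
    fix n assume "N \<le> n"
    have "norm (sigma_coeff \<alpha> (Suc n) * z ^ Suc n)
        = norm (- 1 / (1 + \<alpha>) * z * ?r n) * norm (sigma_coeff \<alpha> n * z ^ n)"
      using assms by (simp add: sigma_coeff_Suc abs_mult mult_ac del: of_nat_Suc)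
    also have "\<dots> \<le> 1 / 2 * norm (sigma_coeff \<alpha> n * z ^ n)"
      using N[OF \<open>N \<le> n\<close>] by (intro mult_right_mono) auto
    finally show "norm (sigma_coeff \<alpha> (Suc n) * z ^ Suc n) \<le> 1 / 2 * norm (sigma_coeff \<alpha> n * z ^ n)" .
  qed simp
qed

lemma sigma_fun_integrable:
  assumes "0 < \<alpha>" "\<alpha> < 1" "0 \<le> x"
  shows "interval_lebesgue_integrable lborel 0 (ereal x) (sigma_fun \<alpha>)"
  using powr_series_integrable[OF summable_sigma_coeff, of \<alpha> \<alpha> "1 + \<alpha>" x] assms
  by (simp add: sigma_fun_eq_series[abs_def])

lemma isCont_sigma_fun:
  assumes "0 < \<alpha>" "\<alpha> < 1" "0 < w"
  shows "isCont (sigma_fun \<alpha>) w"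
proof -
  have "isCont (\<lambda>z. \<Sum>n. sigma_coeff \<alpha> n * z ^ n) z" for z
    using termdiffs_strong_converges_everywhere[OF summable_sigma_coeff[OF assms(1,2)]]
    by (rule DERIV_isCont)
  moreover have "isCont (\<lambda>w. w powr (1 + \<alpha>)) w"
    using assms by (intro continuous_intros) auto
  ultimately have "isCont (\<lambda>w. \<Sum>n. sigma_coeff \<alpha> n * (w powr (1 + \<alpha>)) ^ n) w"
    using isCont_o2 by fast
  then show ?thesis
    unfolding sigma_fun_eq_series[abs_def] using assms by (intro continuous_intros) auto
qed

lemma has_real_derivative_integral_sigma_fun:
  assumes "0 < \<alpha>" "\<alpha> < 1" "0 < x"
  shows "((\<lambda>y. LBINT w=0..ereal y. sigma_fun \<alpha> w) has_real_derivative sigma_fun \<alpha> x) (at x)"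
proof -
  let ?\<sigma> = "sigma_fun \<alpha>"
  \<comment> \<open>\<sigma> is unbounded at 0, so the fundamental theorem is applied with base
    point x on a compact interval away from 0; the integral from 0 to x is then a constant.\<close>
  have "((\<lambda>y. LBINT w=x..y. ?\<sigma> w) has_vector_derivative ?\<sigma> x) (at x within {x / 2..2 * x})"
    using assms
    by (intro interval_integral_FTC2 continuous_at_imp_continuous_on ballI isCont_sigma_fun) auto
  moreover have "at x within {x / 2..2 * x} = at x"
    using assms by (intro at_within_interior) (simp add: interior_atLeastAtMost_real)
  ultimately have deriv: "((\<lambda>y. (LBINT w=0..ereal x. ?\<sigma> w) + (LBINT w=x..y. ?\<sigma> w))
      has_real_derivative ?\<sigma> x) (at x)"
    by (auto intro!: derivative_eq_intros simp: has_real_derivative_iff_has_vector_derivative)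
  have "(LBINT w=0..ereal x. ?\<sigma> w) + (LBINT w=x..y. ?\<sigma> w) = (LBINT w=0..ereal y. ?\<sigma> w)"
    if "0 < y" for y
  proof (rule interval_integral_sum)
    have "min 0 (min (ereal x) (ereal y)) = 0" "max 0 (max (ereal x) (ereal y)) = ereal (max x y)"
      using that assms by (auto simp: min_def max_def zero_ereal_def)
    then show "interval_lebesgue_integrable lborel (min 0 (min (ereal x) (ereal y)))
        (max 0 (max (ereal x) (ereal y))) ?\<sigma>"
      using sigma_fun_integrable[of \<alpha> "max x y"] assms by simp
  qed
  then have "\<forall>\<^sub>F y in nhds x.
      (LBINT w=0..ereal x. ?\<sigma> w) + (LBINT w=x..y. ?\<sigma> w) = (LBINT w=0..ereal y. ?\<sigma> w)"
    using eventually_nhds_in_open[of "{0<..}" x] \<open>0 < x\<close> by (auto elim!: eventually_mono)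
  from DERIV_cong_ev[OF refl this refl] deriv show ?thesis
    by blast
qed

section \<open>The Caputo derivative of the primitive of \<sigma>\<close>

text \<open>Up to the factor \<open>\<Gamma>(1 - \<alpha>)\<close>, these are the coefficients that the Riemann--Liouville
  integral of order \<open>1 - \<alpha>\<close> produces from those of \<open>sigma_fun\<close>.\<close>

definition caputo_sigma_coeff :: "real \<Rightarrow> nat \<Rightarrow> real" where
  "caputo_sigma_coeff \<alpha> n = sigma_coeff \<alpha> n * Gamma ((1 + \<alpha>) * real n + \<alpha>) / Gamma ((1 + \<alpha>) * real n + 1)"

text \<open>The function G of the overview.\<close>

definition caputo_sigma :: "real \<Rightarrow> real \<Rightarrow> real" where
  "caputo_sigma \<alpha> w = (\<Sum>n. caputo_sigma_coeff \<alpha> n * (w powr (1 + \<alpha>)) ^ n)"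

text \<open>With g = (1 + \<alpha>) (n + 1), the recursion contributes
  \<open>Gamma g / Gamma (g + \<alpha>)\<close> and the definition
  \<open>Gamma (g + \<alpha>) / Gamma (g + 1)\<close>. Their product is 1 / g, so no Gamma value
  survives.\<close>

lemma caputo_sigma_coeff_Suc:
  assumes "0 < \<alpha>"
  shows "caputo_sigma_coeff \<alpha> (Suc n) * real (Suc n) = - sigma_coeff \<alpha> n / (1 + \<alpha>)\<^sup>2"
proof -
  define g where "g = (1 + \<alpha>) * real (Suc n)"
  have "g > 0" using assms by (simp add: g_def)
  have Suc: "Gamma (g + 1) = g * Gamma g"
    using \<open>g > 0\<close> by (intro Gamma_plus1) (auto elim!: nonpos_Ints_cases)
  have "Gamma g \<noteq> 0" "Gamma (g + \<alpha>) \<noteq> 0"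
    using Gamma_real_pos[of g] Gamma_real_pos[of "g + \<alpha>"] \<open>g > 0\<close> assms by linarith+
  then have "caputo_sigma_coeff \<alpha> (Suc n) = - sigma_coeff \<alpha> n / ((1 + \<alpha>) * g)"
    unfolding caputo_sigma_coeff_def sigma_coeff_Suc[OF assms] g_def[symmetric] Suc by simp
  then show ?thesis
    using assms by (simp add: g_def power2_eq_square del: of_nat_Suc)
qed

text \<open>By the collapsed recursion, the series shifted by one index is dominated by a multiple
  of the series of \<sigma>.\<close>

lemma summable_caputo_sigma_coeff:
  assumes "0 < \<alpha>" "\<alpha> < 1"
  shows "summable (\<lambda>n. caputo_sigma_coeff \<alpha> n * z ^ n)"
proof -
  have "summable (\<lambda>n. \<bar>sigma_coeff \<alpha> n * z ^ n\<bar> * (\<bar>z\<bar> / (1 + \<alpha>)\<^sup>2))"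
    using powser_insidea[OF summable_sigma_coeff[OF assms, of "\<bar>z\<bar> + 1"], of z]
    by (intro summable_mult2) simp
  then have "summable (\<lambda>n. caputo_sigma_coeff \<alpha> (Suc n) * z ^ Suc n)"
  proof (rule summable_comparison_test'[where N = 0])
    fix n :: nat
    have "caputo_sigma_coeff \<alpha> (Suc n) * z ^ Suc n
        = - (sigma_coeff \<alpha> n * z ^ n * (z / (1 + \<alpha>)\<^sup>2)) / real (Suc n)"
    proof -
      have "caputo_sigma_coeff \<alpha> (Suc n) = - sigma_coeff \<alpha> n / (1 + \<alpha>)\<^sup>2 / real (Suc n)"
        unfolding caputo_sigma_coeff_Suc[OF assms(1), symmetric] by simp
      then show ?thesis by (simp add: mult_ac del: of_nat_Suc)
    qed
    then have "norm (caputo_sigma_coeff \<alpha> (Suc n) * z ^ Suc n)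
        = \<bar>sigma_coeff \<alpha> n * z ^ n\<bar> * (\<bar>z\<bar> / (1 + \<alpha>)\<^sup>2) / real (Suc n)"
      using assms by (simp add: abs_mult del: of_nat_Suc)
    also have "\<dots> \<le> \<bar>sigma_coeff \<alpha> n * z ^ n\<bar> * (\<bar>z\<bar> / (1 + \<alpha>)\<^sup>2)"
      using divide_left_mono[of 1 "real (Suc n)" "\<bar>sigma_coeff \<alpha> n * z ^ n\<bar> * (\<bar>z\<bar> / (1 + \<alpha>)\<^sup>2)"] by simp
    finally show "norm (caputo_sigma_coeff \<alpha> (Suc n) * z ^ Suc n)
        \<le> \<bar>sigma_coeff \<alpha> n * z ^ n\<bar> * (\<bar>z\<bar> / (1 + \<alpha>)\<^sup>2)" .
  qed
  then show ?thesis
    by (subst (asm) summable_Suc_iff)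
qed

text \<open>Termwise differentiation in z = \<open>w powr (1 + \<alpha>)\<close> returns the series
  of \<sigma>. The chain rule factor contains \<open>w powr \<alpha>\<close>, which is w times the
  prefactor of \<sigma>.\<close>

lemma has_real_derivative_caputo_sigma:
  assumes "0 < \<alpha>" "\<alpha> < 1" "0 < w"
  shows "(caputo_sigma \<alpha> has_real_derivative - w * sigma_fun \<alpha> w / (1 + \<alpha>)) (at w)"
proof -
  let ?z = "w powr (1 + \<alpha>)"
  have "diffs (caputo_sigma_coeff \<alpha>) n * ?z ^ n = (- 1 / (1 + \<alpha>)\<^sup>2) * (sigma_coeff \<alpha> n * ?z ^ n)" for n
    using caputo_sigma_coeff_Suc[OF assms(1), of n] by (simp add: diffs_def mult_ac del: of_nat_Suc)
  then have diffs: "(\<Sum>n. diffs (caputo_sigma_coeff \<alpha>) n * ?z ^ n)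
      = (- 1 / (1 + \<alpha>)\<^sup>2) * (\<Sum>n. sigma_coeff \<alpha> n * ?z ^ n)"
    using assms by (simp only: suminf_mult[OF summable_sigma_coeff])
  have "(caputo_sigma \<alpha> has_real_derivative
      (\<Sum>n. diffs (caputo_sigma_coeff \<alpha>) n * ?z ^ n) * ((1 + \<alpha>) * w powr \<alpha>)) (at w)"
    unfolding caputo_sigma_def[abs_def]
  proof (rule DERIV_chain2[where f = "\<lambda>z. \<Sum>n. caputo_sigma_coeff \<alpha> n * z ^ n"])
    show "((\<lambda>z. \<Sum>n. caputo_sigma_coeff \<alpha> n * z ^ n) has_real_derivative
        (\<Sum>n. diffs (caputo_sigma_coeff \<alpha>) n * ?z ^ n)) (at ?z)"
      using assms by (intro termdiffs_strong_converges_everywhere summable_caputo_sigma_coeff)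
    show "((\<lambda>w. w powr (1 + \<alpha>)) has_real_derivative (1 + \<alpha>) * w powr \<alpha>) (at w)"
      using has_real_derivative_powr[of w "1 + \<alpha>"] assms by simp
  qed
  also have "(\<Sum>n. diffs (caputo_sigma_coeff \<alpha>) n * ?z ^ n) * ((1 + \<alpha>) * w powr \<alpha>)
      = - w * sigma_fun \<alpha> w / (1 + \<alpha>)"
  proof -
    have w: "w powr \<alpha> = w * w powr (\<alpha> - 1)"
      using assms powr_add[of w 1 "\<alpha> - 1"] by simp
    have "1 + \<alpha> \<noteq> 0" using assms by simp
    then show ?thesis
      unfolding diffs sigma_fun_eq_series w by (simp add: power2_eq_square)
  qed
  finally show ?thesis .
qed

text \<open>The Caputo derivative sees f only through its derivative, so additive constants
  disappear. Termwise fractional integration with exponents \<alpha> and 1 - \<alpha> gives the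
  value, and its factor \<open>Gamma (1 - \<alpha>)\<close> cancels the normalisation.\<close>

lemma caputo_sigma_fun_scaled:
  fixes f :: "real \<Rightarrow> real"
  assumes \<alpha>: "0 < \<alpha>" "\<alpha> < 1" and "0 < c" "0 < x"
    and f: "\<And>p. 0 < p \<Longrightarrow> (f has_real_derivative k * (c * sigma_fun \<alpha> (c * p))) (at p)"
  shows "caputo_differentiable \<alpha> f x"
    and "caputo_deriv \<alpha> f x = k * c powr \<alpha> * caputo_sigma \<alpha> (c * x)"
proof -
  \<comment> \<open>The dilation by c is absorbed into the coefficients, so the integration lemma
    applies in the variable p.\<close>
  let ?s = "\<lambda>n. sigma_coeff \<alpha> n * (c powr (1 + \<alpha>)) ^ n"
  let ?S = "\<lambda>p. \<Sum>n. ?s n * (p powr (1 + \<alpha>)) ^ n"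
  let ?I = "x powr (\<alpha> + (1 - \<alpha>) - 1) * (\<Sum>n. ?s n * Beta ((1 + \<alpha>) * real n + \<alpha>) (1 - \<alpha>) * (x powr (1 + \<alpha>)) ^ n)"
  let ?g = "\<lambda>p. deriv f p / (x - p) powr \<alpha>"
  have "summable (\<lambda>n. ?s n * z ^ n)" for z
    using summable_sigma_coeff[OF \<alpha>, of "c powr (1 + \<alpha>) * z"] by (simp add: power_mult_distrib mult_ac)
  then have "has_bochner_integral lborel
      (\<lambda>p. indicator {0<..<x} p * (p powr (\<alpha> - 1) * ?S p * (x - p) powr (1 - \<alpha> - 1))) ?I"
    using assms by (intro powr_series_fractional_integral) auto
  then have "has_bochner_integral lborel (\<lambda>p. (k * c powr \<alpha>) *
      (indicator {0<..<x} p * (p powr (\<alpha> - 1) * ?S p * (x - p) powr (1 - \<alpha> - 1)))) (k * c powr \<alpha> * ?I)"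
    by (rule has_bochner_integral_mult_right)
  also have "(\<lambda>p. (k * c powr \<alpha>) * (indicator {0<..<x} p * (p powr (\<alpha> - 1) * ?S p * (x - p) powr (1 - \<alpha> - 1))))
      = (\<lambda>p. indicator {0<..<x} p *\<^sub>R ?g p)"
  proof
    fix p
    show "(k * c powr \<alpha>) * (indicator {0<..<x} p * (p powr (\<alpha> - 1) * ?S p * (x - p) powr (1 - \<alpha> - 1)))
      = indicator {0<..<x} p *\<^sub>R ?g p"
    proof (cases "p \<in> {0<..<x}")
      case True
      then have "deriv f p = k * (c * sigma_fun \<alpha> (c * p))"
        by (intro DERIV_imp_deriv f) simp
      moreover have "c powr \<alpha> = c * c powr (\<alpha> - 1)"
        using assms powr_add[of c 1 "\<alpha> - 1"] by simp
      moreover have "sigma_fun \<alpha> (c * p) = c powr (\<alpha> - 1) * p powr (\<alpha> - 1) * ?S p"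
        using True assms by (simp add: sigma_fun_eq_series powr_mult power_mult_distrib mult.assoc)
      ultimately show ?thesis
        using True by (simp add: powr_minus_divide)
    qed simp
  qed
  finally have int: "has_bochner_integral lborel (\<lambda>p. indicator {0<..<x} p *\<^sub>R ?g p) (k * c powr \<alpha> * ?I)" .
  \<comment> \<open>The outer power of x has exponent 0. Each Beta value splits into
    \<open>Gamma (1 - \<alpha>)\<close> and the Gamma quotient of
    \<open>caputo_sigma_coeff\<close>.\<close>
  have I: "?I = Gamma (1 - \<alpha>) * caputo_sigma \<alpha> (c * x)"
  proof -
    have "?s n * Beta ((1 + \<alpha>) * real n + \<alpha>) (1 - \<alpha>) * (x powr (1 + \<alpha>)) ^ n
        = Gamma (1 - \<alpha>) * (caputo_sigma_coeff \<alpha> n * ((c * x) powr (1 + \<alpha>)) ^ n)" for n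
      using assms by (simp add: Beta_def caputo_sigma_coeff_def powr_mult power_mult_distrib)
    then show ?thesis
      using assms by (simp add: caputo_sigma_def suminf_mult summable_caputo_sigma_coeff)
  qed
  have einterval: "einterval 0 (ereal x) = {0<..<x}"
    by (simp add: zero_ereal_def)
  have "f differentiable (at p)" if "0 < p" for p
    using f[OF that] by (auto simp: real_differentiable_def)
  moreover have "interval_lebesgue_integrable lborel 0 (ereal x) ?g"
    using int \<open>0 < x\<close>
    by (simp add: interval_lebesgue_integrable_def set_integrable_def einterval has_bochner_integral_iff)
  ultimately show "caputo_differentiable \<alpha> f x"
    by (simp add: caputo_differentiable_def)
  have "(LBINT p=0..x. ?g p) = k * c powr \<alpha> * ?I"
    using has_bochner_integral_integral_eq[OF int] \<open>0 < x\<close>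
    by (simp add: interval_lebesgue_integral_le_eq set_lebesgue_integral_def einterval)
  moreover have "Gamma (1 - \<alpha>) > 0"
    using \<alpha> by (intro Gamma_real_pos) simp
  ultimately show "caputo_deriv \<alpha> f x = k * c powr \<alpha> * caputo_sigma \<alpha> (c * x)"
    unfolding caputo_deriv_def I by simp
qed

section \<open>The similarity solution\<close>

text \<open>The integrability conjunct ensures that the integral defining u is genuine, since a
  nonintegrable function would have the default integral 0.\<close>

theorem proposition7:
  fixes \<alpha> T A B :: real
  assumes "0 < \<alpha>" and "\<alpha> < 1" and "0 < T"
  shows "(\<forall>x\<ge>0. \<forall>t\<in>{0<..<T}.
            interval_lebesgue_integrable lborel 0 (x / t powr (1 / (1 + \<alpha>))) (sigma_fun \<alpha>)) \<and>
         space_fractional_diffusion_solution \<alpha> T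
           (\<lambda>x t. A + B * (LBINT w=0..x / t powr (1 / (1 + \<alpha>)). sigma_fun \<alpha> w))"
  unfolding space_fractional_diffusion_solution_def
proof (intro conjI allI impI ballI)
  fix x t :: real
  assume "0 \<le> x" "t \<in> {0<..<T}"
  then show "interval_lebesgue_integrable lborel 0 (x / t powr (1 / (1 + \<alpha>))) (sigma_fun \<alpha>)"
    using assms by (intro sigma_fun_integrable) auto
next
  fix x t :: real
  assume "0 < x" and "t \<in> {0<..<T}"
  then have "0 < t" by simp
  let ?u = "\<lambda>x t. A + B * (LBINT w=0..x / t powr (1 / (1 + \<alpha>)). sigma_fun \<alpha> w)"
  \<comment> \<open>For fixed t, the profile is a dilation by c of the primitive of
    \<sigma>.\<close>
  define c where "c = 1 / t powr (1 / (1 + \<alpha>))"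
  have "0 < c" using \<open>0 < t\<close> by (simp add: c_def)
  have u_c: "?u p t = A + B * (LBINT w=0..ereal (c * p). sigma_fun \<alpha> w)" for p
    by (simp add: c_def)
  have ux: "((\<lambda>p. ?u p t) has_real_derivative B * (c * sigma_fun \<alpha> (c * p))) (at p)" if "0 < p" for p
    unfolding u_c using assms \<open>0 < c\<close> that
    by (auto intro!: derivative_eq_intros DERIV_chain2[OF has_real_derivative_integral_sigma_fun])
  note caputo = caputo_sigma_fun_scaled[OF assms(1,2) \<open>0 < c\<close> _ ux]
  show "caputo_differentiable \<alpha> (\<lambda>p. ?u p t) x"
    using \<open>0 < x\<close> by (rule caputo(1))
  let ?D = "- B * (c * x) * sigma_fun \<alpha> (c * x) / ((1 + \<alpha>) * t)"
  have "((\<lambda>s. ?u x s) has_real_derivative ?D) (at t)"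
  proof -
    have "((\<lambda>s. x / s powr (1 / (1 + \<alpha>))) has_real_derivative - (c * x) / ((1 + \<alpha>) * t)) (at t)"
    proof -
      have "((\<lambda>s. x * s powr (- 1 / (1 + \<alpha>))) has_real_derivative
          x * ((- 1 / (1 + \<alpha>)) * t powr (- 1 / (1 + \<alpha>) - 1))) (at t)"
        using \<open>0 < t\<close> by (intro DERIV_cmult has_real_derivative_powr)
      also have "(\<lambda>s. x * s powr (- 1 / (1 + \<alpha>))) = (\<lambda>s. x / s powr (1 / (1 + \<alpha>)))"
        by (simp add: powr_minus_divide)
      \<comment> \<open>Differentiating the similarity variable in time only multiplies it by -1 /
        ((1 + \<alpha>) t).\<close>
      also have "t powr (- 1 / (1 + \<alpha>) - 1) = c / t"
        using \<open>0 < t\<close> by (simp add: powr_diff powr_minus_divide c_def)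
      finally show ?thesis by (simp add: mult_ac)
    qed
    moreover have "((\<lambda>y. LBINT w=0..ereal y. sigma_fun \<alpha> w) has_real_derivative
        sigma_fun \<alpha> (c * x)) (at (x / t powr (1 / (1 + \<alpha>))))"
      using has_real_derivative_integral_sigma_fun[of \<alpha> "c * x"] assms \<open>0 < c\<close> \<open>0 < x\<close>
      by (simp add: c_def)
    ultimately have "((\<lambda>s. LBINT w=0..x / s powr (1 / (1 + \<alpha>)). sigma_fun \<alpha> w) has_real_derivative
        sigma_fun \<alpha> (c * x) * (- (c * x) / ((1 + \<alpha>) * t))) (at t)"
      by (intro DERIV_chain2)
    then show ?thesis
      by (auto intro!: derivative_eq_intros)
  qed
  moreover have "((\<lambda>y. caputo_deriv \<alpha> (\<lambda>p. ?u p t) y) has_real_derivative ?D) (at x)"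
  proof -
    have "((\<lambda>y. caputo_sigma \<alpha> (c * y)) has_real_derivative
        (- (c * x) * sigma_fun \<alpha> (c * x) / (1 + \<alpha>)) * c) (at x)"
      using assms \<open>0 < c\<close> \<open>0 < x\<close>
      by (intro DERIV_chain2[OF has_real_derivative_caputo_sigma]) (auto intro!: derivative_eq_intros)
    then have "((\<lambda>y. B * c powr \<alpha> * caputo_sigma \<alpha> (c * y)) has_real_derivative
        B * c powr \<alpha> * ((- (c * x) * sigma_fun \<alpha> (c * x) / (1 + \<alpha>)) * c)) (at x)"
      by (rule DERIV_cmult)
    moreover have "B * c powr \<alpha> * ((- (c * x) * sigma_fun \<alpha> (c * x) / (1 + \<alpha>)) * c) = ?D"
    proof -
      \<comment> \<open>The choice of the similarity exponent enters here: it gives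
        \<open>c powr (1 + \<alpha>)\<close> = 1 / t, which matches the space side with the time
        side.\<close>
      have "c = t powr (- 1 / (1 + \<alpha>))"
        by (simp add: c_def powr_minus_divide)
      then have "c powr (1 + \<alpha>) = t powr (- 1)"
        using assms by (simp add: powr_powr)
      then have "c powr \<alpha> * c = 1 / t"
        using \<open>0 < c\<close> \<open>0 < t\<close> by (simp add: powr_add powr_minus_divide mult.commute)
      moreover have "B * c powr \<alpha> * ((- (c * x) * sigma_fun \<alpha> (c * x) / (1 + \<alpha>)) * c)
          = (c powr \<alpha> * c) * (- B * (c * x) * sigma_fun \<alpha> (c * x) / (1 + \<alpha>))"
        by simp
      ultimately show ?thesis by simp
    qed
    ultimately have "((\<lambda>y. B * c powr \<alpha> * caputo_sigma \<alpha> (c * y)) has_real_derivative ?D) (at x)"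
      by simp
    \<comment> \<open>The closed form is known only for y > 0, which suffices for a derivative at x
      > 0.\<close>
    moreover have "\<forall>\<^sub>F y in nhds x. caputo_deriv \<alpha> (\<lambda>p. ?u p t) y = B * c powr \<alpha> * caputo_sigma \<alpha> (c * y)"
      using eventually_nhds_in_open[of "{0<..}" x] \<open>0 < x\<close>
      by (auto elim!: eventually_mono intro: caputo(2))
    ultimately show ?thesis
      by (subst DERIV_cong_ev[OF refl _ refl])
  qed
  ultimately show "\<exists>D. ((\<lambda>s. ?u x s) has_real_derivative D) (at t) \<and>
      ((\<lambda>y. caputo_deriv \<alpha> (\<lambda>p. ?u p t) y) has_real_derivative D) (at x)"
    by blast
qed

end
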